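(* Let $X$ be a partially ordered normed space, $\mathcal{C}$ the ordering cone, and $x_0\in A\subset X$. Assume that either of the following statements holds. (i) $x_0\in\mathrm{Pos}(A,\mathcal{C})$ and take $g\in\mathcal{C}^{\#}$ such that $x_0\in\mathcal{Q}\mathrm{Min}(A)$ for $\mathcal{Q}=\{x\in X: g(x)>0\}$. (ii) $x_0\in\mathrm{Hu}(A,\mathcal{C})$ and take $\mathcal{Q}=-(X\setminus\overline{\mathrm{co}}(\mathcal{K}))$ for $\mathcal{K}:=\mathrm{cone}((A-x_0)\cup\mathcal{C})$. (iii) $x_0\in\mathrm{Be}(A,\mathcal{C})$ and take $\mathcal{Q}=-(X\setminus\overline{\mathrm{cone}}(A-x_0+\mathcal{C}))$. (iv) $x_0\in\mathrm{Ha}(A,\mathcal{C})$ and take $\mathcal{Q}=\mathcal{C}(\varepsilon)$ for some $0<\varepsilon<1$. (v) $x_0\in\mathrm{Bo}(A,\mathcal{C})$ and take $\mathcal{Q}$ an open cone dilating $\mathcal{C}$. (vi) $x_0\in\mathrm{GHe}(A,\mathcal{C})$ and take $\mathcal{Q}$ a pointed convex open cone dilating $\mathcal{C}$. (vii) $x_0\in\mathrm{He}(A,\mathcal{C})$ and take $\mathcal{Q}=V_\eta(B)$, $0<\eta<\delta_B$, for some base $B$ of $\mathcal{C}$. (viii) $x_0\in\mathrm{SE}(A,\mathcal{C})$ and take $\mathcal{Q}=V_\eta(B)$, $0<\eta<\delta_B$, for some bounded base $B$ of $\mathcal{C}$. (ix) $x_0\in\mathrm{TBo}(A,\mathcal{C})$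 and take $\mathcal{Q}=-(X\setminus T(A+\mathcal{C},x_0))$. If $(\mathcal{C},\mathcal{Q}_0)$ has the strict separation property (SSP), then there exists $(f,\alpha)\in\mathcal{C}^{a\#}_+$ such that $$\min_{x\in A}\ f(x-x_0)+\alpha\|x-x_0\|$$ is attained only at $x_0$.
   Context: $X$ is a normed space with origin $0_X$, dual $X^*$, closed unit ball $B_X$, open unit ball $B_X^\circ$, unit sphere $S_X$. For $S\subset X$: $\overline S$, $\mathrm{bd}(S)$, $\mathrm{int}(S)$, $\mathrm{co}(S)$, $\overline{\mathrm{co}}(S)$ are the closure, boundary, interior, convex hull, closed convex hull; $S_0:=S\cup\{0_X\}$; $\mathrm{cone}(S):=\{\lambda s:\lambda\ge0,\ s\in S\}$ and $\overline{\mathrm{cone}}(S)$ is its closure. A cone is a set closed under multiplication by all $\lambda\ge0$; all cones are assumed non-trivial (different from $\{0_X\}$ and $X$). A cone $\mathcal{C}$ is pointed if $(-\mathcal{C})\cap\mathcal{C}=\{0_X\}$. A partially ordered normed space with ordering cone $\mathcal{C}$ is a normed space with a (non-trivial) pointed convex cone $\mathcal{C}$, ordered by $x\le y\Leftrightarrow y-x\in\mathcal{C}$. An open cone is an open set $\mathcal{Q}$ such that $\mathcal{Q}_0$ is a (non-trivial) cone; it is pointed (convex) if $\mathcal{Q}_0$ is. $\mathcal{Q}$ dilates $\mathcal{C}$ if $\mathcal{C}\setminus\{0_X\}\subset\mathcal{Q}$. $x_0\in\mathcal{Q}\mathrm{Min}(A)$ means $x_0\in A$ and $(A-x_0)\cap(-\mathcal{Q})=\emptyset$.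 For a convex cone $\mathcal{C}$, a base is a non-empty convex $B\subset\mathcal{C}$ with $0_X\notin\overline B$ such that every $x\in\mathcal{C}\setminus\{0_X\}$ is uniquely $x=\lambda b$ with $\lambda>0$, $b\in B$; $\delta_B:=\inf\{\|b\|:b\in B\}>0$. For $0<\eta<\delta_B$, $V_\eta(B):=\{\lambda s:\lambda>0,\ s\in B+\eta B_X^\circ\}$. For $0<\varepsilon<1$, $\mathcal{C}(\varepsilon):=\{x\in X: d(x,\mathcal{C})<\varepsilon\, d(x,-\mathcal{C})\}$, $d$ being the distance to a set. $T(A,\bar x):=\{\lim_n\lambda_n(x_n-\bar x): \lambda_n>0,\ x_n\in A,\ x_n\to\bar x\}$ is the contingent cone to $A$ at $\bar x\in\overline A$. $\mathcal{C}^*:=\{f\in X^*: f\ge0\text{ on }\mathcal{C}\}$, $\mathcal{C}^{\#}:=\{f\in X^*: f(x)>0\ \forall x\in\mathcal{C}\setminus\{0_X\}\}$, $\mathcal{C}^{a\#}_+:=\{(f,\alpha)\in\mathcal{C}^{\#}\times(0,\infty): f(x)-\alpha\|x\|>0\ \forall x\in\mathcal{C}\setminus\{0_X\}\}$. For a cone $\mathcal{K}$, $x_0\in\mathrm{Min}(A,\mathcal{K})$ means $x_0\in A$ and $(x_0-\mathcal{K})\cap A=\{x_0\}$. Proper efficient points, for $x_0\in A$: - $x_0\in\mathrm{Pos}(A,\mathcal{C})$ (positive): there is $f\in\mathcal{C}^{\#}$ with $f(x_0)=\inf_A f$. - $x_0\in\mathrm{Hu}(A,\mathcal{C})$ (Hurwicz):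 $\overline{\mathrm{co}}(\mathrm{cone}((A-x_0)\cup\mathcal{C}))\cap(-\mathcal{C})=\{0_X\}$. - $x_0\in\mathrm{Be}(A,\mathcal{C})$ (Benson): $0_X\in\mathrm{Min}(\overline{\mathrm{cone}}(A+\mathcal{C}-x_0),\mathcal{C})$. - $x_0\in\mathrm{Ha}(A,\mathcal{C})$ (Hartley): $x_0\in\mathrm{Min}(A,\mathcal{C})$ and there is $M>0$ such that if $f\in\mathcal{C}^*$ and $f(x-x_0)<0$ for some $x\in A$, then there is $g\in\mathcal{C}^*$, $g\ne0$, with $\|g\|f(x-x_0)\ge-\|f\|M g(x-x_0)$. - $x_0\in\mathrm{Bo}(A,\mathcal{C})$ (Borwein): $\overline{\mathrm{cone}}(A-x_0)\cap(-\mathcal{C})=\{0_X\}$. - $x_0\in\mathrm{GHe}(A,\mathcal{C})$ (Henig global): $x_0\in\mathrm{Min}(A,\mathcal{K})$ for some convex cone $\mathcal{K}$ with $\mathcal{C}\setminus\{0_X\}\subset\mathrm{int}(\mathcal{K})$. - $x_0\in\mathrm{He}(A,\mathcal{C})$ (Henig): $\mathcal{C}$ has a base $B$ and there is $\varepsilon>0$ with $\overline{\mathrm{cone}}(A-x_0)\cap(-\overline{\mathrm{cone}}(B+\varepsilon B_X))=\{0_X\}$. - $x_0\in\mathrm{SE}(A,\mathcal{C})$ (super efficient): there is $\rho>0$ with $\overline{\mathrm{cone}}(A-x_0)\cap(B_X-\mathcal{C})\subset\rho B_X$. - $x_0\in\mathrm{TBo}(A,\mathcal{C})$ (tangentially Borwein):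 $T(A+\mathcal{C},x_0)\cap(-\mathcal{C})=\{0_X\}$. For a cone $\mathcal{C}$, $\mathcal{C}_{\wedge}:=\mathrm{co}(\mathcal{C}\cap S_X)$ and $\mathcal{C}_{\vee}:=\mathrm{co}((\mathrm{bd}(\mathcal{C})\cap S_X)_0)$. The pair of cones $(\mathcal{C},\mathcal{K})$ has the strict separation property (SSP) if $0_X\notin\overline{\mathcal{C}_{\wedge}-\mathcal{K}_{\vee}}$.
   Formalization: In (iv)–(ix) the formal theorem also assumes that x_0 ∈ QMin(A) for the chosen Q, which the text states only in (i); without this the claim is false in those cases (finite sets A in R^3 with the nonnegative orthant give counterexamples). *)

theory Defs
  imports "HOL-Analysis.Analysis" "HOL-Library.Set_Algebras"
begin

text \<open>
  Conventions. The dual space is the type of bounded linear functionals with the operator norm.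
  Set addition is the Minkowski sum, but \<open>-\<close> on sets is complement or set difference, so
  negatives and differences of sets are written as images or comprehensions.
  The cone generated by \<open>S\<close> is the library's \<open>cone hull S\<close>, which is
  \<open>{c *\<^sub>R x | c x. 0 \<le> c \<and> x \<in> S}\<close> by \<open>cone_hull_expl\<close>.
\<close>

text \<open>The library predicate \<open>cone\<close> also holds for the empty set, which is excluded here.\<close>

definition nontrivial_cone :: "'a::real_normed_vector set \<Rightarrow> bool" where
  "nontrivial_cone K \<longleftrightarrow> cone K \<and> K \<noteq> {} \<and> K \<noteq> {0} \<and> K \<noteq> UNIV"

definition pointed :: "'a::real_normed_vector set \<Rightarrow> bool" where
  "pointed K \<longleftrightarrow> uminus ` K \<inter> K = {0}"

definition ordering_cone :: "'a::real_normed_vector set \<Rightarrow> bool" where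
  "ordering_cone C \<longleftrightarrow> nontrivial_cone C \<and> convex C \<and> pointed C"

definition open_cone :: "'a::real_normed_vector set \<Rightarrow> bool" where
  "open_cone Q \<longleftrightarrow> open Q \<and> nontrivial_cone (insert 0 Q)"

definition dilates :: "'a::real_normed_vector set \<Rightarrow> 'a set \<Rightarrow> bool" where
  "dilates Q C \<longleftrightarrow> C - {0} \<subseteq> Q"

definition QMin :: "'a::real_normed_vector set \<Rightarrow> 'a set \<Rightarrow> 'a set" where
  "QMin Q A = {x0 \<in> A. (\<lambda>x. x - x0) ` A \<inter> uminus ` Q = {}}"

definition MinK :: "'a::real_normed_vector set \<Rightarrow> 'a set \<Rightarrow> 'a set" where
  "MinK A K = {x0 \<in> A. (\<lambda>k. x0 - k) ` K \<inter> A = {x0}}"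

definition is_base :: "'a::real_normed_vector set \<Rightarrow> 'a set \<Rightarrow> bool" where
  "is_base B C \<longleftrightarrow> B \<noteq> {} \<and> convex B \<and> B \<subseteq> C \<and> 0 \<notin> closure B \<and>
     (\<forall>x\<in>C - {0}. \<exists>!(l :: real, b). l > 0 \<and> b \<in> B \<and> x = l *\<^sub>R b)"

definition base_dist :: "'a::real_normed_vector set \<Rightarrow> real" where
  "base_dist B = (INF b\<in>B. norm b)"

definition V_cone :: "real \<Rightarrow> 'a::real_normed_vector set \<Rightarrow> 'a set" where
  "V_cone \<eta> B = {l *\<^sub>R s | l s. l > 0 \<and> s \<in> B + ball 0 \<eta>}"

definition conic_nbhd :: "'a::real_normed_vector set \<Rightarrow> real \<Rightarrow> 'a set" where
  "conic_nbhd C \<epsilon> = {x. infdist x C < \<epsilon> * infdist x (uminus ` C)}"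

definition contingent_cone :: "'a::real_normed_vector set \<Rightarrow> 'a \<Rightarrow> 'a set" where
  "contingent_cone A xb = {v. \<exists>(l :: nat \<Rightarrow> real) (x :: nat \<Rightarrow> 'a).
     (\<forall>n. l n > 0) \<and> (\<forall>n. x n \<in> A) \<and> x \<longlonglongrightarrow> xb \<and> (\<lambda>n. l n *\<^sub>R (x n - xb)) \<longlonglongrightarrow> v}"

definition dual_cone :: "'a::real_normed_vector set \<Rightarrow> ('a \<Rightarrow>\<^sub>L real) set" where
  "dual_cone C = {f. \<forall>x\<in>C. blinfun_apply f x \<ge> 0}"

definition strict_dual :: "'a::real_normed_vector set \<Rightarrow> ('a \<Rightarrow>\<^sub>L real) set" where
  "strict_dual C = {f. \<forall>x\<in>C - {0}. blinfun_apply f x > 0}"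

definition augmented_dual :: "'a::real_normed_vector set \<Rightarrow> (('a \<Rightarrow>\<^sub>L real) \<times> real) set" where
  "augmented_dual C = {(f, \<alpha>). f \<in> strict_dual C \<and> \<alpha> > 0 \<and>
     (\<forall>x\<in>C - {0}. blinfun_apply f x - \<alpha> * norm x > 0)}"

text \<open>
  In \<open>Pos\<close>, boundedness below is stated explicitly because the real infimum of a set that is
  not bounded below is an unspecified real number.
\<close>

definition Pos :: "'a::real_normed_vector set \<Rightarrow> 'a set \<Rightarrow> 'a set" where
  "Pos A C = {x0 \<in> A. \<exists>f\<in>strict_dual C.
     bdd_below (blinfun_apply f ` A) \<and> blinfun_apply f x0 = (INF x\<in>A. blinfun_apply f x)}"

definition Hu :: "'a::real_normed_vector set \<Rightarrow> 'a set \<Rightarrow> 'a set" where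
  "Hu A C = {x0 \<in> A.
     closure (convex hull (cone hull ((\<lambda>x. x - x0) ` A \<union> C))) \<inter> uminus ` C = {0}}"

definition Be :: "'a::real_normed_vector set \<Rightarrow> 'a set \<Rightarrow> 'a set" where
  "Be A C = {x0 \<in> A. 0 \<in> MinK (closure (cone hull ((\<lambda>x. x - x0) ` (A + C)))) C}"

definition Ha :: "'a::real_normed_vector set \<Rightarrow> 'a set \<Rightarrow> 'a set" where
  "Ha A C = {x0 \<in> A. x0 \<in> MinK A C \<and>
     (\<exists>M>0. \<forall>f\<in>dual_cone C. \<forall>x\<in>A. blinfun_apply f (x - x0) < 0 \<longrightarrow>
        (\<exists>g\<in>dual_cone C. g \<noteq> 0 \<and>
           norm g * blinfun_apply f (x - x0) \<ge> - (norm f * M * blinfun_apply g (x - x0))))}"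

definition Bo :: "'a::real_normed_vector set \<Rightarrow> 'a set \<Rightarrow> 'a set" where
  "Bo A C = {x0 \<in> A. closure (cone hull ((\<lambda>x. x - x0) ` A)) \<inter> uminus ` C = {0}}"

definition GHe :: "'a::real_normed_vector set \<Rightarrow> 'a set \<Rightarrow> 'a set" where
  "GHe A C = {x0 \<in> A. \<exists>K. nontrivial_cone K \<and> convex K \<and> C - {0} \<subseteq> interior K \<and> x0 \<in> MinK A K}"

definition He :: "'a::real_normed_vector set \<Rightarrow> 'a set \<Rightarrow> 'a set" where
  "He A C = {x0 \<in> A. \<exists>B. is_base B C \<and> (\<exists>\<epsilon>>0.
     closure (cone hull ((\<lambda>x. x - x0) ` A)) \<inter>
     uminus ` closure (cone hull (B + cball 0 \<epsilon>)) = {0})}"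

definition SE :: "'a::real_normed_vector set \<Rightarrow> 'a set \<Rightarrow> 'a set" where
  "SE A C = {x0 \<in> A. \<exists>\<rho>>0.
     closure (cone hull ((\<lambda>x. x - x0) ` A)) \<inter> (cball 0 1 + uminus ` C) \<subseteq> cball 0 \<rho>}"

definition TBo :: "'a::real_normed_vector set \<Rightarrow> 'a set \<Rightarrow> 'a set" where
  "TBo A C = {x0 \<in> A. contingent_cone (A + C) x0 \<inter> uminus ` C = {0}}"

definition cone_wedge :: "'a::real_normed_vector set \<Rightarrow> 'a set" where
  "cone_wedge C = convex hull (C \<inter> sphere 0 1)"

definition cone_vee :: "'a::real_normed_vector set \<Rightarrow> 'a set" where
  "cone_vee K = convex hull (insert 0 (frontier K \<inter> sphere 0 1))"

definition SSP :: "'a::real_normed_vector set \<Rightarrow> 'a set \<Rightarrow> bool" where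
  "SSP C K \<longleftrightarrow> 0 \<notin> closure {x - y | x y. x \<in> cone_wedge C \<and> y \<in> cone_vee K}"

end

theory Submission imports Defs begin

text \<open>
  Hahn--Banach turns the strict separation property into \<open>f\<close> and \<open>\<alpha> > 0\<close> such that
  \<open>f x > \<alpha> \<parallel>x\<parallel>\<close> on \<open>C - {0}\<close> and \<open>f y < \<alpha> \<parallel>y\<parallel>\<close> on the nonzero boundary points of \<open>Q\<close>. The convex
  set \<open>{y. y \<noteq> 0 \<and> f y \<ge> \<alpha> \<parallel>y\<parallel>}\<close> meets \<open>Q\<close> but not its boundary, so it lies in \<open>Q\<close>; since
  \<open>A - x0\<close> avoids \<open>- Q\<close>, the functional \<open>f + \<alpha> \<parallel>\<cdot>\<parallel>\<close> is positive on \<open>(A - x0) - {0}\<close>.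
  All nine cases provide the same three facts: \<open>Q\<close> is closed under positive scaling, it contains
  a nonzero point of \<open>C\<close>, and \<open>A - x0\<close> avoids \<open>- Q\<close>.
\<close>

section \<open>Dominated linear functionals\<close>

text \<open>Homogeneity is only required as an inequality, the form that passes easily to infima;
  equality for \<open>0 \<le> t\<close> follows by scaling back with \<open>inverse t\<close>. The
  case \<open>t = 0\<close> is included and forces \<open>q 0 = 0\<close>.\<close>

definition sublinear :: "('a::real_vector \<Rightarrow> real) \<Rightarrow> bool" where
  "sublinear q \<longleftrightarrow> (\<forall>x y. q (x + y) \<le> q x + q y) \<and> (\<forall>t x. 0 \<le> t \<longrightarrow> q (t *\<^sub>R x) \<le> t * q x)"

lemma sublinearD:
  assumes "sublinear q"
  shows "q (x + y) \<le> q x + q y" and "0 \<le> t \<Longrightarrow> q (t *\<^sub>R x) \<le> t * q x"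
  using assms by (auto simp: sublinear_def)

lemma sublinear_zero: "sublinear q \<Longrightarrow> q 0 = 0"
  using sublinearD(1)[of q 0 0] sublinearD(2)[of q 0 0] by simp

lemma sublinear_minus: "sublinear q \<Longrightarrow> - q (- x) \<le> q x"
  using sublinearD(1)[of q x "- x"] sublinear_zero[of q] by simp

lemma sublinear_scaleR:
  assumes q: "sublinear q" and "0 \<le> t"
  shows "q (t *\<^sub>R x) = t * q x"
proof (cases "t = 0")
  case True
  then show ?thesis by (simp add: sublinear_zero[OF q])
next
  case False
  then have t: "0 < t" using assms by simp
  have "q (inverse t *\<^sub>R (t *\<^sub>R x)) \<le> inverse t * q (t *\<^sub>R x)"
    using t by (intro sublinearD(2)[OF q]) simp
  then have "t * q x \<le> q (t *\<^sub>R x)" using t by (simp add: field_simps)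
  then show ?thesis using sublinearD(2)[OF q \<open>0 \<le> t\<close>, of x] by simp
qed

text \<open>The index \<open>k\<close> may depend on the data, so one criterion serves a chain of
  functionals, a one-parameter family and the conical hull of a convex set. For subadditivity the
  two infima on the right are taken one after the other, with the other index held fixed.\<close>

lemma sublinear_INF:
  fixes g :: "'i \<Rightarrow> 'a::real_vector \<Rightarrow> real"
  assumes ne: "I \<noteq> {}" and bdd: "\<And>x. bdd_below ((\<lambda>i. g i x) ` I)"
    and add: "\<And>i j x y. i \<in> I \<Longrightarrow> j \<in> I \<Longrightarrow> \<exists>k\<in>I. g k (x + y) \<le> g i x + g j y"
    and scale: "\<And>i t x. i \<in> I \<Longrightarrow> 0 \<le> t \<Longrightarrow> \<exists>k\<in>I. g k (t *\<^sub>R x) \<le> t * g i x"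
  shows "sublinear (\<lambda>x. INF i\<in>I. g i x)"
  unfolding sublinear_def
proof (intro conjI allI impI)
  fix x y
  have *: "(INF i\<in>I. g i (x + y)) \<le> g i x + g j y" if "i \<in> I" "j \<in> I" for i j
    using add[OF that] cINF_lower[OF bdd] by (meson order_trans)
  have **: "(INF i\<in>I. g i (x + y)) - g i x \<le> (INF j\<in>I. g j y)" if "i \<in> I" for i
  proof (rule cINF_greatest[OF ne])
    fix j assume "j \<in> I"
    then show "(INF i\<in>I. g i (x + y)) - g i x \<le> g j y" using *[OF that, of j] by simp
  qed
  have "(INF i\<in>I. g i (x + y)) - (INF j\<in>I. g j y) \<le> (INF i\<in>I. g i x)"
  proof (rule cINF_greatest[OF ne])
    fix i assume "i \<in> I"
    then show "(INF i\<in>I. g i (x + y)) - (INF j\<in>I. g j y) \<le> g i x" using **[of i] by simp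
  qed
  then show "(INF i\<in>I. g i (x + y)) \<le> (INF i\<in>I. g i x) + (INF i\<in>I. g i y)" by simp
next
  fix t :: real and x
  assume t: "0 \<le> t"
  have *: "(INF i\<in>I. g i (t *\<^sub>R x)) \<le> t * g i x" if "i \<in> I" for i
    using scale[OF that t] cINF_lower[OF bdd] by (meson order_trans)
  show "(INF i\<in>I. g i (t *\<^sub>R x)) \<le> t * (INF i\<in>I. g i x)"
  proof (cases "t = 0")
    case True
    then show ?thesis using * ne by auto
  next
    case False
    then have "0 < t" using t by simp
    then have "(INF i\<in>I. g i (t *\<^sub>R x)) / t \<le> (INF i\<in>I. g i x)"
      using * by (intro cINF_greatest[OF ne]) (simp add: field_simps)
    then show ?thesis using \<open>0 < t\<close> by (simp add: field_simps)
  qed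
qed

text \<open>Zorn's lemma for the reversed pointwise order: the pointwise infimum of a nonempty chain
  is again sublinear and bounds the chain from below.\<close>

lemma minimal_sublinear_exists:
  assumes p: "sublinear p"
  obtains q where "sublinear q" "q \<le> p" "\<And>r. sublinear r \<Longrightarrow> r \<le> q \<Longrightarrow> r = q"
proof -
  define S where "S = {q. sublinear q \<and> q \<le> p}"
  define R where "R = relation_of (\<lambda>a b :: 'a \<Rightarrow> real. b \<le> a) S"
  have "partial_order_on S R"
    unfolding R_def by (rule partial_order_on_relation_ofI) auto
  moreover have "\<exists>u\<in>S. \<forall>a\<in>K. u \<le> a" if K: "K \<in> Chains R" for K
  proof (cases "K = {}")
    case True
    then show ?thesis using p by (auto simp: S_def)
  next
    case False
    have KS: "a \<in> S" if "a \<in> K" for a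
      using K that by (auto simp: Chains_def R_def relation_of_def)
    have tot: "a \<le> b \<or> b \<le> a" if "a \<in> K" "b \<in> K" for a b
      using K that by (auto simp: Chains_def R_def relation_of_def)
    \<comment> \<open>The bound is uniform over the chain:
      \<open>a x \<ge> - a (- x) \<ge> - p (- x)\<close> because \<open>a \<le> p\<close>.\<close>
    have bdd: "bdd_below ((\<lambda>a. a x) ` K)" for x
    proof (rule bdd_belowI2)
      fix a assume "a \<in> K"
      then have "sublinear a" "a (- x) \<le> p (- x)" using KS by (auto simp: S_def le_fun_def)
      then show "- p (- x) \<le> a x" using sublinear_minus[of a x] by simp
    qed
    define u where "u x = (INF a\<in>K. a x)" for x
    have le: "u \<le> a" if "a \<in> K" for a
      unfolding u_def le_fun_def using cINF_lower[OF bdd that] by simp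
    have "sublinear u"
      unfolding u_def
    proof (rule sublinear_INF[OF False bdd])
      fix a b x y assume ab: "a \<in> K" "b \<in> K"
      \<comment> \<open>The smaller of the two comparable functionals is the witness.\<close>
      show "\<exists>k\<in>K. k (x + y) \<le> a x + b y"
        using tot[OF ab]
      proof
        assume "a \<le> b"
        then have "a y \<le> b y" by (simp add: le_fun_def)
        then show ?thesis using sublinearD(1)[of a x y] KS[OF ab(1)] ab
          by (intro bexI[of _ a]) (auto simp: S_def)
      next
        assume "b \<le> a"
        then have "b x \<le> a x" by (simp add: le_fun_def)
        then show ?thesis using sublinearD(1)[of b x y] KS[OF ab(2)] ab
          by (intro bexI[of _ b]) (auto simp: S_def)
      qed
    next
      fix a x and t :: real assume "a \<in> K" "0 \<le> t"
      then show "\<exists>k\<in>K. k (t *\<^sub>R x) \<le> t * a x"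
        using sublinearD(2) KS by (intro bexI[of _ a]) (auto simp: S_def)
    qed
    moreover have "u \<le> p"
      using False le KS by (auto simp: S_def intro: order_trans)
    ultimately show ?thesis using le by (auto simp: S_def)
  qed
  ultimately obtain m where "m \<in> S" "\<forall>a\<in>S. a \<le> m \<longrightarrow> a = m"
    using predicate_Zorn[of S "\<lambda>a b. b \<le> a"] unfolding R_def by blast
  \<comment> \<open>Whatever lies below \<open>m\<close> lies below \<open>p\<close>, so minimality
    in \<open>S\<close> is minimality among all sublinear functionals.\<close>
  then show thesis
    by (intro that[of m]) (auto simp: S_def intro: order_trans)
qed

text \<open>
  For minimal \<open>q\<close> and any \<open>a\<close>, the sublinear functional \<open>x \<mapsto> inf {q (x + s a) - s q a | s. s \<ge> 0}\<close>
  is dominated by \<open>q\<close>, hence equal to \<open>q\<close>; at \<open>- a\<close> with \<open>s = 1\<close> this gives \<open>q (- a) \<le> - q a\<close>.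
\<close>

lemma minimal_sublinear_linear:
  assumes q: "sublinear q" and min: "\<And>r. sublinear r \<Longrightarrow> r \<le> q \<Longrightarrow> r = q"
  shows "linear q"
proof -
  have neg: "q (- a) = - q a" for a
  proof -
    define g where "g s x = q (x + s *\<^sub>R a) - s * q a" for s x
    \<comment> \<open>Writing \<open>s *\<^sub>R a\<close> as
      \<open>(x + s *\<^sub>R a) + (- x)\<close> gives a lower bound independent of
      \<open>s\<close>.\<close>
    have bdd: "bdd_below ((\<lambda>s. g s x) ` {0..})" for x
    proof (rule bdd_belowI2)
      fix s :: real assume "s \<in> {0..}"
      then have "q (s *\<^sub>R a) = s * q a" using sublinear_scaleR[OF q] by simp
      moreover have "q (s *\<^sub>R a) \<le> q (x + s *\<^sub>R a) + q (- x)"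
        using sublinearD(1)[OF q, of "x + s *\<^sub>R a" "- x"] by simp
      ultimately show "- q (- x) \<le> g s x" by (simp add: g_def)
    qed
    have "sublinear (\<lambda>x. INF s\<in>{0..}. g s x)"
    proof (rule sublinear_INF[OF _ bdd])
      fix s t :: real and x y assume "s \<in> {0..}" "t \<in> {0..}"
      then show "\<exists>k\<in>{0..}. g k (x + y) \<le> g s x + g t y"
        using sublinearD(1)[OF q, of "x + s *\<^sub>R a" "y + t *\<^sub>R a"]
        by (intro bexI[of _ "s + t"]) (auto simp: g_def algebra_simps)
    next
      fix s t :: real and x assume "s \<in> {0..}" "0 \<le> t"
      then show "\<exists>k\<in>{0..}. g k (t *\<^sub>R x) \<le> t * g s x"
        using sublinearD(2)[OF q, of t "x + s *\<^sub>R a"]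
        by (intro bexI[of _ "t * s"]) (auto simp: g_def algebra_simps)
    qed simp
    moreover have "(\<lambda>x. INF s\<in>{0..}. g s x) \<le> q"
      unfolding le_fun_def
    proof
      fix x
      \<comment> \<open>The index \<open>s = 0\<close> gives \<open>q x\<close> itself.\<close>
      show "(INF s\<in>{0..}. g s x) \<le> q x"
        using cINF_lower[OF bdd, of 0 x] by (simp add: g_def)
    qed
    ultimately have "(INF s\<in>{0..}. g s (- a)) = q (- a)" by (auto dest: min fun_cong)
    moreover have "(INF s\<in>{0..}. g s (- a)) \<le> g 1 (- a)"
      by (intro cINF_lower[OF bdd]) simp
    ultimately have "q (- a) \<le> - q a" by (simp add: g_def sublinear_zero[OF q])
    then show ?thesis using sublinear_minus[OF q, of a] by simp
  qed
  show ?thesis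
  proof (rule linearI)
    fix x y
    \<comment> \<open>Subadditivity at \<open>- x\<close> and \<open>- y\<close> becomes the reverse
      inequality once \<open>q\<close> is odd.\<close>
    show "q (x + y) = q x + q y"
      using sublinearD(1)[OF q, of x y] sublinearD(1)[OF q, of "- x" "- y"] neg[of "x + y"] neg[of x] neg[of y]
      by simp
  next
    fix t :: real and x
    show "q (t *\<^sub>R x) = t *\<^sub>R q x"
    proof (cases "0 \<le> t")
      case True
      then show ?thesis using sublinear_scaleR[OF q] by simp
    next
      case False
      then show ?thesis using sublinear_scaleR[OF q, of "- t" x] neg[of "t *\<^sub>R x"] by simp
    qed
  qed
qed

lemma dominated_linear_functional:
  assumes "sublinear p"
  obtains f where "linear f" "\<And>x. f x \<le> p x"
  using minimal_sublinear_exists[OF assms] minimal_sublinear_linear by (metis le_funD)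

text \<open>With \<delta> a lower bound for the norm on \<open>D\<close>, the infimum of
  \<open>norm (x + t *\<^sub>R d) - t * \<delta>\<close> over \<open>t \<ge> 0\<close> and
  \<open>d \<in> D\<close> is sublinear, at most \<open>norm x\<close>, and at most
  \<open>- \<delta>\<close> at every \<open>- d\<close>. A linear functional below it is therefore
  bounded and at least \<delta> on \<open>D\<close>.\<close>

lemma separating_functional:
  fixes D :: "'a::real_normed_vector set"
  assumes "convex D" and "D \<noteq> {}" and "0 \<notin> closure D"
  obtains f :: "'a \<Rightarrow>\<^sub>L real" and \<delta> where "0 < \<delta>" "\<And>d. d \<in> D \<Longrightarrow> \<delta> \<le> blinfun_apply f d"
proof -
  obtain \<delta> where \<delta>: "0 < \<delta>" and far: "\<And>d. d \<in> D \<Longrightarrow> \<delta> \<le> norm d"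
    using assms(3) by (auto simp: closure_approachable not_less)
  define I where "I = {0::real..} \<times> D"
  define g where "g i x = norm (x + fst i *\<^sub>R snd i) - fst i * \<delta>" for i and x :: 'a
  have bdd: "bdd_below ((\<lambda>i. g i x) ` I)" for x
  proof (rule bdd_belowI2)
    fix i assume "i \<in> I"
    then have i: "0 \<le> fst i" "snd i \<in> D" by (auto simp: I_def)
    have "fst i * \<delta> \<le> norm (fst i *\<^sub>R snd i)"
      using i far by (simp add: mult_left_mono)
    also have "\<dots> \<le> norm (x + fst i *\<^sub>R snd i) + norm x"
      using norm_triangle_ineq4[of "x + fst i *\<^sub>R snd i" x] by simp
    finally show "- norm x \<le> g i x" by (simp add: g_def)
  qed
  have "sublinear (\<lambda>x. INF i\<in>I. g i x)"
  proof (rule sublinear_INF[OF _ bdd])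
    fix i j x y assume "i \<in> I" "j \<in> I"
    then obtain s d t e where ij: "i = (s, d)" "j = (t, e)" "0 \<le> s" "0 \<le> t" "d \<in> D" "e \<in> D"
      by (auto simp: I_def)
    \<comment> \<open>Convexity of \<open>D\<close> enters here: nonnegative multiples of points of
      \<open>D\<close> add up to such a multiple, with \<open>b\<close> the weighted mean, or any
      point of \<open>D\<close> when both weights vanish.\<close>
    obtain b where b: "b \<in> D" "(s + t) *\<^sub>R b = s *\<^sub>R d + t *\<^sub>R e"
    proof (cases "s + t = 0")
      case True
      then have "s = 0" "t = 0" using ij by auto
      then show ?thesis using that ij by auto
    next
      case False
      then have st: "0 < s + t" using ij by auto
      have "(s / (s + t)) *\<^sub>R d + (t / (s + t)) *\<^sub>R e \<in> D"
        using st ij by (intro convexD[OF assms(1)]) (auto simp: add_divide_distrib[symmetric])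
      then show ?thesis using st by (intro that) (auto simp: scaleR_add_right)
    qed
    have "x + y + (s + t) *\<^sub>R b = (x + s *\<^sub>R d) + (y + t *\<^sub>R e)"
      unfolding b(2) by simp
    then have "norm (x + y + (s + t) *\<^sub>R b) \<le> norm (x + s *\<^sub>R d) + norm (y + t *\<^sub>R e)"
      by (metis norm_triangle_ineq)
    then show "\<exists>k\<in>I. g k (x + y) \<le> g i x + g j y"
      using b ij by (intro bexI[of _ "(s + t, b)"]) (auto simp: g_def I_def algebra_simps)
  next
    fix i and x :: 'a and t :: real assume "i \<in> I" "0 \<le> t"
    moreover from this have "norm (t *\<^sub>R x + (t * s) *\<^sub>R d) = t * norm (x + s *\<^sub>R d)" for s d
      by (metis abs_of_nonneg norm_scaleR scaleR_add_right scaleR_scaleR)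
    ultimately show "\<exists>k\<in>I. g k (t *\<^sub>R x) \<le> t * g i x"
      by (intro bexI[of _ "(t * fst i, snd i)"]) (auto simp: g_def I_def algebra_simps)
  qed (use assms in \<open>auto simp: I_def\<close>)
  then obtain f where f: "linear f" "\<And>x. f x \<le> (INF i\<in>I. g i x)"
    using dominated_linear_functional by blast
  have le: "f x \<le> norm (x + t *\<^sub>R d) - t * \<delta>" if "0 \<le> t" "d \<in> D" for x t d
    using order_trans[OF f(2) cINF_lower[OF bdd, of "(t, d)"]] that by (simp add: I_def g_def)
  obtain d0 where "d0 \<in> D" using assms by auto
  \<comment> \<open>Weight \<open>0\<close> yields the norm bound; weight \<open>1\<close> at
    \<open>- d\<close> below yields \<open>\<delta> \<le> f d\<close>.\<close>
  then have fn: "f x \<le> norm x" for x using le[of 0 d0] by simp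
  have "bounded_linear f"
    using f(1) fn fn[of "- x" for x]
    by (intro bounded_linear_intro[of _ 1])
      (auto simp: linear_add linear_scale abs_le_iff linear_neg)
  moreover have "\<delta> \<le> f d" if "d \<in> D" for d
    using le[of 1 d "- d"] that by (simp add: linear_neg[OF f(1)])
  ultimately show thesis
    using \<delta> by (intro that[of \<delta> "Blinfun f"]) (auto simp: bounded_linear_Blinfun_apply)
qed

section \<open>The separating cone\<close>

text \<open>Only positive scalars are allowed, so the property says nothing about \<open>0\<close>
  and, unlike \<open>cone\<close>, passes to complements and hence to frontiers.\<close>

definition pos_homogeneous :: "'a::real_vector set \<Rightarrow> bool" where
  "pos_homogeneous S \<longleftrightarrow> (\<forall>t>0. \<forall>x\<in>S. t *\<^sub>R x \<in> S)"

lemma pos_homogeneousD: "pos_homogeneous S \<Longrightarrow> 0 < t \<Longrightarrow> x \<in> S \<Longrightarrow> t *\<^sub>R x \<in> S"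
  by (simp add: pos_homogeneous_def)

lemma pos_homogeneous_insert_0: "pos_homogeneous S \<Longrightarrow> pos_homogeneous (insert 0 S)"
  by (auto simp: pos_homogeneous_def)

lemma pos_homogeneous_cone: "cone S \<Longrightarrow> pos_homogeneous S"
  by (simp add: pos_homogeneous_def cone_def)

lemma pos_homogeneous_Compl:
  assumes "pos_homogeneous S"
  shows "pos_homogeneous (- S)"
  unfolding pos_homogeneous_def
proof (intro allI impI ballI)
  fix t :: real and x assume "0 < t" "x \<in> - S"
  then show "t *\<^sub>R x \<in> - S"
    using pos_homogeneousD[OF assms, of "inverse t" "t *\<^sub>R x"] by auto
qed

lemma pos_homogeneous_closure:
  fixes S :: "'a::real_normed_vector set"
  assumes "pos_homogeneous S"
  shows "pos_homogeneous (closure S)"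
  unfolding pos_homogeneous_def
proof (intro allI impI ballI)
  fix t :: real and x assume "0 < t" "x \<in> closure S"
  then have "t *\<^sub>R x \<in> closure ((*\<^sub>R) t ` S)" by (auto simp flip: closure_scaleR)
  moreover have "(*\<^sub>R) t ` S \<subseteq> S" using assms \<open>0 < t\<close> by (auto simp: pos_homogeneous_def)
  ultimately show "t *\<^sub>R x \<in> closure S" using closure_mono by blast
qed

lemma pos_homogeneous_frontier:
  fixes S :: "'a::real_normed_vector set"
  assumes "pos_homogeneous S"
  shows "pos_homogeneous (frontier S)"
  using pos_homogeneous_closure[OF assms] pos_homogeneous_closure[OF pos_homogeneous_Compl[OF assms]]
  by (simp add: pos_homogeneous_def frontier_closures)

text \<open>Separating the difference set from \<open>0\<close> leaves a gap \<delta> between the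
  values of \<open>f\<close> on unit vectors of \<open>C\<close> and on unit frontier vectors of
  \<open>K\<close>; a level inside the gap serves as \<alpha>, and scaling extends both inequalities
  to all nonzero vectors.\<close>

lemma SSP_functional:
  fixes C K :: "'a::real_normed_vector set"
  assumes C: "nontrivial_cone C" and K: "pos_homogeneous K" and "SSP C K"
  obtains f :: "'a \<Rightarrow>\<^sub>L real" and \<alpha> where "0 < \<alpha>"
    "\<And>x. x \<in> C - {0} \<Longrightarrow> \<alpha> * norm x < blinfun_apply f x"
    "\<And>y. y \<in> frontier K - {0} \<Longrightarrow> blinfun_apply f y < \<alpha> * norm y"
proof -
  define D where "D = {x - y | x y. x \<in> cone_wedge C \<and> y \<in> cone_vee K}"
  have unit: "inverse (norm x) *\<^sub>R x \<in> C \<inter> sphere 0 1" if "x \<in> C - {0}" for x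
    using that C by (auto simp: nontrivial_cone_def cone_def)
  obtain c where c: "c \<in> C - {0}"
    using C by (auto simp: nontrivial_cone_def)
  let ?U = "inverse (norm c) *\<^sub>R c"
  have wedge: "x \<in> cone_wedge C" if "x \<in> C \<inter> sphere 0 1" for x
    using that by (simp add: cone_wedge_def hull_inc)
  have vee: "y \<in> cone_vee K" if "y = 0 \<or> y \<in> frontier K \<inter> sphere 0 1" for y
    using that by (auto simp: cone_vee_def intro: hull_inc)
  have "D = (\<Union>x\<in>cone_wedge C. \<Union>y\<in>cone_vee K. {x - y})"
    by (auto simp: D_def)
  then have "convex D"
    by (simp add: convex_differences cone_wedge_def cone_vee_def)
  moreover have "D \<noteq> {}" using wedge[OF unit[OF c]] vee[of 0] by (auto simp: D_def)
  moreover have "0 \<notin> closure D" using assms(3) by (simp add: SSP_def D_def)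
  ultimately obtain f :: "'a \<Rightarrow>\<^sub>L real" and \<delta> where \<delta>: "0 < \<delta>"
    and f: "\<And>d. d \<in> D \<Longrightarrow> \<delta> \<le> blinfun_apply f d"
    using separating_functional by blast
  have sep: "blinfun_apply f y + \<delta> \<le> blinfun_apply f x"
    if "x \<in> C \<inter> sphere 0 1" "y = 0 \<or> y \<in> frontier K \<inter> sphere 0 1" for x y
    using f[of "x - y"] wedge[OF that(1)] vee[OF that(2)] by (force simp: D_def blinfun.diff_right)
  define m where "m = (INF x\<in>C \<inter> sphere 0 1. blinfun_apply f x)"
  have ne: "C \<inter> sphere 0 1 \<noteq> {}" using unit[OF c] by blast
  have bdd: "bdd_below (blinfun_apply f ` (C \<inter> sphere 0 1))"
    using sep[of _ 0] by (intro bdd_belowI2[of _ \<delta>]) simp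
  have m: "blinfun_apply f y + \<delta> \<le> m" if "y = 0 \<or> y \<in> frontier K \<inter> sphere 0 1" for y
    unfolding m_def using sep that by (intro cINF_greatest[OF ne]) auto
  show thesis
  \<comment> \<open>The midpoint of the gap: \<open>f\<close> is at least \<open>m\<close> on unit
    vectors of \<open>C\<close> and at most \<open>m - \<delta>\<close> on unit frontier vectors.
    The point \<open>0\<close> in \<open>cone_vee K\<close> gives \<open>\<delta> \<le> m\<close>,
    so this level is positive.\<close>
  proof (rule that[of "m - \<delta> / 2" f])
    show "0 < m - \<delta> / 2" using m[of 0] \<delta> by simp
  next
    fix x assume x: "x \<in> C - {0}"
    have "m \<le> blinfun_apply f (inverse (norm x) *\<^sub>R x)"
      unfolding m_def by (intro cINF_lower[OF bdd] unit[OF x])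
    then have "m * norm x \<le> blinfun_apply f x"
      using x by (simp add: blinfun.scaleR_right field_simps)
    moreover have "0 < \<delta> / 2 * norm x" using \<delta> x by simp
    ultimately show "(m - \<delta> / 2) * norm x < blinfun_apply f x" by (simp add: left_diff_distrib)
  next
    fix y assume y: "y \<in> frontier K - {0}"
    have "inverse (norm y) *\<^sub>R y \<in> frontier K"
      using y by (intro pos_homogeneousD[OF pos_homogeneous_frontier[OF K]]) auto
    then have "blinfun_apply f (inverse (norm y) *\<^sub>R y) + \<delta> \<le> m"
      using y by (intro m) simp
    then have "blinfun_apply f y + \<delta> * norm y \<le> m * norm y"
      using y by (simp add: blinfun.scaleR_right field_simps)
    moreover have "0 < \<delta> / 2 * norm y" using \<delta> y by simp
    ultimately show "blinfun_apply f y < (m - \<delta> / 2) * norm y" by (simp add: left_diff_distrib)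
  qed
qed

text \<open>A connected set that meets \<open>insert 0 Q\<close> and misses its frontier lies inside
  it.\<close>

lemma subset_if_frontier_below:
  fixes f :: "'a::real_normed_vector \<Rightarrow>\<^sub>L real"
  assumes \<alpha>: "0 < \<alpha>" and fr: "\<And>y. y \<in> frontier (insert 0 Q) - {0} \<Longrightarrow> blinfun_apply f y < \<alpha> * norm y"
    and q: "q \<in> Q" "q \<noteq> 0" "\<alpha> * norm q \<le> blinfun_apply f q"
    and y: "y \<noteq> 0" "\<alpha> * norm y \<le> blinfun_apply f y"
  shows "y \<in> Q"
proof -
  \<comment> \<open>The condition \<open>0 < blinfun_apply f y\<close> removes exactly the apex
    \<open>0\<close>, possibly a frontier point, and visibly preserves convexity.\<close>
  define P where "P = {y. 0 < blinfun_apply f y \<and> \<alpha> * norm y \<le> blinfun_apply f y}"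
  have P: "x \<in> P \<longleftrightarrow> x \<noteq> 0 \<and> \<alpha> * norm x \<le> blinfun_apply f x" for x
    using \<alpha> by (auto simp: P_def intro: less_le_trans[of 0 "\<alpha> * norm x"])
  have "convex P"
  proof (rule convexI)
    fix x y and u v :: real
    assume xy: "x \<in> P" "y \<in> P" and uv: "0 \<le> u" "0 \<le> v" "u + v = 1"
    have "\<alpha> * norm (u *\<^sub>R x + v *\<^sub>R y) \<le> \<alpha> * (u * norm x + v * norm y)"
      using \<alpha> uv norm_triangle_ineq[of "u *\<^sub>R x" "v *\<^sub>R y"] by (intro mult_left_mono) auto
    also have "\<dots> = u * (\<alpha> * norm x) + v * (\<alpha> * norm y)" by (simp add: algebra_simps)
    also have "\<dots> \<le> u * blinfun_apply f x + v * blinfun_apply f y"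
      using xy uv by (intro add_mono mult_left_mono) (auto simp: P_def)
    finally have "\<alpha> * norm (u *\<^sub>R x + v *\<^sub>R y) \<le> blinfun_apply f (u *\<^sub>R x + v *\<^sub>R y)"
      by (simp add: blinfun.add_right blinfun.scaleR_right)
    moreover have "0 < u * blinfun_apply f x + v * blinfun_apply f y"
      using xy uv by (cases "u = 0") (auto simp: P_def intro: add_pos_nonneg)
    ultimately show "u *\<^sub>R x + v *\<^sub>R y \<in> P"
      by (simp add: P_def blinfun.add_right blinfun.scaleR_right)
  qed
  moreover have "P \<inter> frontier (insert 0 Q) = {}"
    using fr by (fastforce simp: P)
  moreover have "q \<in> P \<inter> insert 0 Q" "y \<in> P" using q y by (auto simp: P)
  ultimately have "y \<in> insert 0 Q"
    using connected_Int_frontier[OF convex_connected, of P "insert 0 Q"] by blast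
  then show ?thesis using y by simp
qed

lemma SSP_arg_min:
  fixes C A Q :: "'a::real_normed_vector set"
  assumes C: "nontrivial_cone C" and A: "x0 \<in> A"
    and Q: "pos_homogeneous Q"
    and meet: "(C - {0}) \<inter> Q \<noteq> {}" and min: "x0 \<in> QMin Q A" and SSP: "SSP C (insert 0 Q)"
  shows "\<exists>(f, \<alpha>) \<in> augmented_dual C.
           {x. is_arg_min (\<lambda>x. blinfun_apply f (x - x0) + \<alpha> * norm (x - x0)) (\<lambda>x. x \<in> A) x} = {x0}"
proof -
  obtain f :: "'a \<Rightarrow>\<^sub>L real" and \<alpha> where \<alpha>: "0 < \<alpha>"
    and fC: "\<And>x. x \<in> C - {0} \<Longrightarrow> \<alpha> * norm x < blinfun_apply f x"
    and fQ: "\<And>y. y \<in> frontier (insert 0 Q) - {0} \<Longrightarrow> blinfun_apply f y < \<alpha> * norm y"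
    by (rule SSP_functional[OF C pos_homogeneous_insert_0[OF Q] SSP]) (rule that)
  have fpos: "0 < blinfun_apply f x" if "x \<in> C - {0}" for x
    using fC[OF that] \<alpha> by (intro le_less_trans[of 0 "\<alpha> * norm x"]) auto
  obtain q where q: "q \<in> C - {0}" "q \<in> Q" using meet by blast
  \<comment> \<open>The objective vanishes at \<open>x0\<close>, so positivity elsewhere on
    \<open>A\<close> gives both minimality and uniqueness.\<close>
  have pos: "0 < blinfun_apply f (x - x0) + \<alpha> * norm (x - x0)" if x: "x \<in> A" "x \<noteq> x0" for x
  proof (rule ccontr)
    assume "\<not> ?thesis"
    then have "\<alpha> * norm (x0 - x) \<le> blinfun_apply f (x0 - x)"
      by (simp add: blinfun.diff_right norm_minus_commute)
    moreover have "q \<noteq> 0" "\<alpha> * norm q \<le> blinfun_apply f q" "x0 - x \<noteq> 0"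
      using x q fC[OF q(1)] by auto
    ultimately have "x0 - x \<in> Q"
      using subset_if_frontier_below[where f = f and q = q, OF \<alpha> fQ q(2)] by metis
    then have "x - x0 \<in> uminus ` Q" by (intro image_eqI[of _ _ "x0 - x"]) auto
    then show False using min x by (auto simp: QMin_def)
  qed
  show ?thesis
  proof (rule bexI[of _ "(f, \<alpha>)"])
    show "(f, \<alpha>) \<in> augmented_dual C"
      using \<alpha> fC fpos by (auto simp: augmented_dual_def strict_dual_def)
    have "is_arg_min (\<lambda>x. blinfun_apply f (x - x0) + \<alpha> * norm (x - x0)) (\<lambda>x. x \<in> A) x \<longleftrightarrow> x = x0" for x
      using A pos by (cases "x = x0") (force simp: is_arg_min_def)+
    then show "case (f, \<alpha>) of (f, \<alpha>) \<Rightarrow>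
        {x. is_arg_min (\<lambda>x. blinfun_apply f (x - x0) + \<alpha> * norm (x - x0)) (\<lambda>x. x \<in> A) x} = {x0}"
      unfolding prod.case by auto
  qed
qed

section \<open>The dilating sets\<close>

lemma pos_homogeneous_uminus_Compl:
  assumes "pos_homogeneous L"
  shows "pos_homogeneous (uminus ` (UNIV - L))"
  using pos_homogeneous_Compl[OF assms] by (force simp: pos_homogeneous_def)

lemma meets_uminus_Compl:
  assumes "nontrivial_cone C" and "L \<inter> uminus ` C = {0}"
  shows "(C - {0}) \<inter> uminus ` (UNIV - L) \<noteq> {}"
proof -
  obtain c where c: "c \<in> C" "c \<noteq> 0" using assms(1) by (auto simp: nontrivial_cone_def)
  then have "- c \<in> uminus ` C" "- c \<noteq> 0" by auto
  then have "- c \<notin> L" using assms(2) by blast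
  then have "c \<in> uminus ` (UNIV - L)" by (intro image_eqI[of _ _ "- c"]) auto
  then show ?thesis using c by blast
qed

lemma QMin_uminus_Compl:
  assumes "x0 \<in> A" and "(\<lambda>x. x - x0) ` A \<subseteq> L"
  shows "x0 \<in> QMin (uminus ` (UNIV - L)) A"
  using assms by (auto simp: QMin_def image_image)

section \<open>Cones dilating \<open>C\<close>\<close>

lemma meets_if_dilates:
  assumes "nontrivial_cone C" and "dilates Q C"
  shows "(C - {0}) \<inter> Q \<noteq> {}"
  using assms by (auto simp: nontrivial_cone_def dilates_def)

lemma pos_homogeneous_open_cone:
  assumes "open_cone Q"
  shows "pos_homogeneous Q"
  unfolding pos_homogeneous_def
proof (intro allI impI ballI)
  fix t :: real and x assume tx: "0 < t" "x \<in> Q"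
  show "t *\<^sub>R x \<in> Q"
  proof (cases "x = 0")
    case False
    have "cone (insert 0 Q)" using assms by (simp add: open_cone_def nontrivial_cone_def)
    then have "t *\<^sub>R x \<in> insert 0 Q" using tx mem_cone[of "insert 0 Q" x t] by simp
    then show ?thesis using tx False by simp
  qed (use tx in simp)
qed

lemma pos_homogeneous_V_cone: "pos_homogeneous (V_cone \<eta> B)"
  unfolding pos_homogeneous_def V_cone_def by (fastforce intro: mult_pos_pos)

lemma dilates_V_cone:
  assumes "is_base B C" and "0 < \<eta>"
  shows "dilates (V_cone \<eta> B) C"
  unfolding dilates_def
proof
  fix x assume "x \<in> C - {0}"
  then obtain l b where "0 < l" "b \<in> B" "x = l *\<^sub>R b"
    using assms(1) unfolding is_base_def by blast
  moreover from this have "b + 0 \<in> B + ball 0 \<eta>" using assms(2) by (intro set_plus_intro) auto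
  ultimately show "x \<in> V_cone \<eta> B" by (auto simp: V_cone_def)
qed

section \<open>The contingent cone\<close>

lemma pos_homogeneous_contingent_cone: "pos_homogeneous (contingent_cone A x)"
  unfolding pos_homogeneous_def
proof (intro allI impI ballI)
  fix t :: real and v assume t: "0 < t" and "v \<in> contingent_cone A x"
  then obtain l :: "nat \<Rightarrow> real" and u where lu: "\<And>n. 0 < l n" "\<And>n. u n \<in> A" "u \<longlonglongrightarrow> x"
    "(\<lambda>n. l n *\<^sub>R (u n - x)) \<longlonglongrightarrow> v"
    by (auto simp: contingent_cone_def)
  have "(\<lambda>n. (t * l n) *\<^sub>R (u n - x)) \<longlonglongrightarrow> t *\<^sub>R v"
    using tendsto_scaleR[OF tendsto_const[of t] lu(4)] by simp
  then show "t *\<^sub>R v \<in> contingent_cone A x"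
    unfolding contingent_cone_def using lu t
    by (intro CollectI exI[of _ "\<lambda>n. t * l n"] exI[of _ u]) auto
qed

section \<open>Conic neighbourhoods defined by distances\<close>

lemma infdist_scaleR_cone:
  fixes S :: "'a::real_normed_vector set"
  assumes S: "cone S" "S \<noteq> {}" and t: "0 < t"
  shows "infdist (t *\<^sub>R x) S = t * infdist x S"
proof -
  have le: "infdist (r *\<^sub>R y) S \<le> r * infdist y S" if r: "0 < r" for r :: real and y
  proof -
    have "infdist (r *\<^sub>R y) S / r \<le> dist y s" if "s \<in> S" for s
    proof -
      have "infdist (r *\<^sub>R y) S \<le> dist (r *\<^sub>R y) (r *\<^sub>R s)"
        using S that r by (intro infdist_le) (simp add: cone_def)
      also have "\<dots> = r * dist y s"
        using r by (simp add: dist_norm flip: scaleR_diff_right)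
      finally show ?thesis using r by (simp add: field_simps)
    qed
    then have "infdist (r *\<^sub>R y) S / r \<le> infdist y S"
      using S by (simp add: infdist_notempty cINF_greatest)
    then show ?thesis using r by (simp add: field_simps)
  qed
  \<comment> \<open>The reverse inequality is the first one applied to the factor
    \<open>inverse t\<close>.\<close>
  have "infdist (inverse t *\<^sub>R (t *\<^sub>R x)) S \<le> inverse t * infdist (t *\<^sub>R x) S"
    using t by (intro le) simp
  then have "t * infdist x S \<le> infdist (t *\<^sub>R x) S" using t by (simp add: field_simps)
  then show ?thesis using le[OF t, of x] by simp
qed

lemma pos_homogeneous_conic_nbhd:
  assumes "nontrivial_cone C"
  shows "pos_homogeneous (conic_nbhd C \<epsilon>)"
proof -
  have "cone (uminus ` C)" "cone C" "C \<noteq> {}"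
    using assms by (auto simp: nontrivial_cone_def cone_def)
  then show ?thesis by (simp add: pos_homogeneous_def conic_nbhd_def infdist_scaleR_cone)
qed

text \<open>
  As \<open>C\<close> need not be closed, \<open>conic_nbhd C \<epsilon>\<close> can be disjoint from \<open>C\<close>; a functional that is
  strictly positive on \<open>C\<close>, which the separation property provides, excludes this.
\<close>

lemma meets_conic_nbhd:
  fixes f :: "'a::real_normed_vector \<Rightarrow>\<^sub>L real"
  assumes C: "nontrivial_cone C" and f: "\<And>x. x \<in> C - {0} \<Longrightarrow> 0 < blinfun_apply f x" and "0 < \<epsilon>"
  shows "(C - {0}) \<inter> conic_nbhd C \<epsilon> \<noteq> {}"
proof -
  obtain c where c: "c \<in> C" "c \<noteq> 0" using C by (auto simp: nontrivial_cone_def)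
  have "0 \<le> blinfun_apply f x" if "x \<in> C" for x
    using f[of x] that by (cases "x = 0") auto
  then have "uminus ` C \<subseteq> {x. blinfun_apply f x \<le> 0}" by (auto simp: blinfun.minus_right)
  \<comment> \<open>A closed half-space separates \<open>c\<close> from \<open>- C\<close>, so
    \<open>c\<close> has positive distance to \<open>- C\<close> but distance \<open>0\<close> to
    \<open>C\<close>.\<close>
  then have "closure (uminus ` C) \<subseteq> {x. blinfun_apply f x \<le> 0}"
    by (intro closure_minimal closed_Collect_le continuous_intros)
  then have "c \<notin> closure (uminus ` C)" using f[of c] c by auto
  then have "0 < infdist c (uminus ` C)"
    using c in_closure_iff_infdist_zero[of "uminus ` C" c] infdist_nonneg[of c "uminus ` C"]
    by (auto simp: less_le)
  then have "c \<in> conic_nbhd C \<epsilon>" using c \<open>0 < \<epsilon>\<close> by (simp add: conic_nbhd_def)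
  then show ?thesis using c by blast
qed

text \<open>Shared by the Hurwicz and Benson cases, where the \<open>QMin\<close> condition comes
  from \<open>A - x0\<close> lying in \<open>L\<close>, the complement of
  \<open>- Q\<close>.\<close>

lemma uminus_Compl_cone:
  fixes C A L :: "'a::real_normed_vector set"
  assumes "nontrivial_cone C" and "x0 \<in> A" and "cone L" and "L \<inter> uminus ` C = {0}"
    and "(\<lambda>x. x - x0) ` A \<subseteq> L" and "Q = uminus ` (UNIV - L)"
  shows "pos_homogeneous Q \<and> (C - {0}) \<inter> Q \<noteq> {} \<and> x0 \<in> QMin Q A"
  using assms meets_uminus_Compl[of C L] QMin_uminus_Compl[of x0 A L]
    pos_homogeneous_uminus_Compl[OF pos_homogeneous_cone, of L] by simp

theorem corollary3p7:
  fixes C A Q :: "'a::real_normed_vector set" and x0 :: 'a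
  assumes "ordering_cone C"
    and "x0 \<in> A"
    and "(x0 \<in> Pos A C \<and>
            (\<exists>g\<in>strict_dual C. Q = {x. blinfun_apply g x > 0} \<and> x0 \<in> QMin Q A))
       \<or> (x0 \<in> Hu A C \<and>
            Q = uminus ` (UNIV - closure (convex hull (cone hull ((\<lambda>x. x - x0) ` A \<union> C)))))
       \<or> (x0 \<in> Be A C \<and>
            Q = uminus ` (UNIV - closure (cone hull ((\<lambda>x. x - x0) ` A + C))))
       \<or> (x0 \<in> Ha A C \<and>
            (\<exists>\<epsilon>. 0 < \<epsilon> \<and> \<epsilon> < 1 \<and> Q = conic_nbhd C \<epsilon>) \<and> x0 \<in> QMin Q A)
       \<or> (x0 \<in> Bo A C \<and>
            open_cone Q \<and> dilates Q C \<and> x0 \<in> QMin Q A)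
       \<or> (x0 \<in> GHe A C \<and>
            open_cone Q \<and> pointed (insert 0 Q) \<and> convex (insert 0 Q) \<and> dilates Q C \<and> x0 \<in> QMin Q A)
       \<or> (x0 \<in> He A C \<and>
            (\<exists>B \<eta>. is_base B C \<and> 0 < \<eta> \<and> \<eta> < base_dist B \<and> Q = V_cone \<eta> B) \<and> x0 \<in> QMin Q A)
       \<or> (x0 \<in> SE A C \<and>
            (\<exists>B \<eta>. is_base B C \<and> bounded B \<and> 0 < \<eta> \<and> \<eta> < base_dist B \<and> Q = V_cone \<eta> B) \<and> x0 \<in> QMin Q A)
       \<or> (x0 \<in> TBo A C \<and>
            Q = uminus ` (UNIV - contingent_cone (A + C) x0) \<and> x0 \<in> QMin Q A)"
    and "SSP C (insert 0 Q)"
  shows "\<exists>(f, \<alpha>) \<in> augmented_dual C.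
           {x. is_arg_min (\<lambda>x. blinfun_apply f (x - x0) + \<alpha> * norm (x - x0)) (\<lambda>x. x \<in> A) x} = {x0}"
proof -
  have C: "nontrivial_cone C" using assms(1) by (simp add: ordering_cone_def)
  then have C0: "0 \<in> C" using cone_contains_0 unfolding nontrivial_cone_def by blast
  let ?A = "(\<lambda>x. x - x0) ` A"
  let ?good = "pos_homogeneous Q \<and> (C - {0}) \<inter> Q \<noteq> {} \<and> x0 \<in> QMin Q A"
  have ?good
    using assms(3)
  proof (elim disjE conjE exE bexE)
    fix g assume g: "g \<in> strict_dual C" "Q = {x. blinfun_apply g x > 0}" "x0 \<in> QMin Q A"
    then have "dilates Q C" by (auto simp: strict_dual_def dilates_def)
    then show ?good using g meets_if_dilates[OF C] by (auto simp: pos_homogeneous_def blinfun.scaleR_right)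
  next
    assume Hu: "x0 \<in> Hu A C" and Q: "Q = uminus ` (UNIV - closure (convex hull (cone hull (?A \<union> C))))"
    have "?A \<subseteq> closure (convex hull (cone hull (?A \<union> C)))"
      by (meson Un_upper1 closure_subset hull_subset order_trans)
    then show ?good
      using Hu Q by (intro uminus_Compl_cone[OF C assms(2)])
        (auto simp: Hu_def intro!: cone_closure cone_convex_hull cone_cone_hull)
  next
    assume Be: "x0 \<in> Be A C" and Q: "Q = uminus ` (UNIV - closure (cone hull (?A + C)))"
    \<comment> \<open>\<open>Be\<close> translates after adding \<open>C\<close>, while
      \<open>Q\<close> is built from the set translated first.\<close>
    have "(\<lambda>x. x - x0) ` (A + C) = ?A + C"
    proof
      show "(\<lambda>x. x - x0) ` (A + C) \<subseteq> ?A + C"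
      proof (clarsimp elim!: set_plus_elim)
        fix a c assume "a \<in> A" "c \<in> C"
        then have "(a - x0) + c \<in> ?A + C" by (intro set_plus_intro) auto
        then show "a + c - x0 \<in> ?A + C" by (simp add: algebra_simps)
      qed
      show "?A + C \<subseteq> (\<lambda>x. x - x0) ` (A + C)"
      proof (clarsimp elim!: set_plus_elim)
        fix a c assume "a \<in> A" "c \<in> C"
        then show "a - x0 + c \<in> (\<lambda>x. x - x0) ` (A + C)"
          by (intro image_eqI[of _ _ "a + c"] set_plus_intro) (simp_all add: algebra_simps)
      qed
    qed
    then have "closure (cone hull (?A + C)) \<inter> uminus ` C = {0}"
      using Be by (auto simp: Be_def MinK_def)
    \<comment> \<open>Adding \<open>0 \<in> C\<close> recovers every point of
      \<open>?A\<close>.\<close>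
    moreover have "?A \<subseteq> ?A + C" using C0 set_zero_plus2 by (simp add: add.commute)
    then have "?A \<subseteq> closure (cone hull (?A + C))"
      by (meson closure_subset hull_subset order_trans)
    ultimately show ?good
      using Q by (intro uminus_Compl_cone[OF C assms(2)]) (auto intro!: cone_closure cone_cone_hull)
  next
    fix \<epsilon> assume \<epsilon>: "0 < \<epsilon>" "Q = conic_nbhd C \<epsilon>" and min: "x0 \<in> QMin Q A"
    have hom: "pos_homogeneous Q" using pos_homogeneous_conic_nbhd[OF C] \<epsilon>(2) by simp
    \<comment> \<open>The separation property is applied already here, to obtain a functional
      strictly positive on \<open>C - {0}\<close>.\<close>
    obtain f :: "'a \<Rightarrow>\<^sub>L real" and \<alpha> where f: "0 < \<alpha>"
      "\<And>x. x \<in> C - {0} \<Longrightarrow> \<alpha> * norm x < blinfun_apply f x"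
      by (rule SSP_functional[OF C pos_homogeneous_insert_0[OF hom] assms(4)]) (rule that)
    have "0 < blinfun_apply f x" if "x \<in> C - {0}" for x
      using f(2)[OF that] f(1) by (intro le_less_trans[of 0 "\<alpha> * norm x"]) auto
    then have "(C - {0}) \<inter> Q \<noteq> {}"
      unfolding \<epsilon>(2) by (rule meets_conic_nbhd[OF C _ \<epsilon>(1)])
    then show ?good using hom min by blast
  next
    assume "open_cone Q" "dilates Q C" "x0 \<in> QMin Q A"
    then show ?good using pos_homogeneous_open_cone meets_if_dilates[OF C] by simp
  next
    assume "open_cone Q" "dilates Q C" "x0 \<in> QMin Q A"
    then show ?good using pos_homogeneous_open_cone meets_if_dilates[OF C] by simp
  next
    fix B \<eta> assume "is_base B C" "0 < \<eta>" "Q = V_cone \<eta> B" "x0 \<in> QMin Q A"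
    then show ?good using pos_homogeneous_V_cone meets_if_dilates[OF C dilates_V_cone] by simp
  next
    fix B \<eta> assume "is_base B C" "0 < \<eta>" "Q = V_cone \<eta> B" "x0 \<in> QMin Q A"
    then show ?good using pos_homogeneous_V_cone meets_if_dilates[OF C dilates_V_cone] by simp
  next
    assume "x0 \<in> TBo A C" "Q = uminus ` (UNIV - contingent_cone (A + C) x0)" "x0 \<in> QMin Q A"
    then show ?good
      using pos_homogeneous_uminus_Compl[OF pos_homogeneous_contingent_cone] meets_uminus_Compl[OF C]
      by (auto simp: TBo_def)
  qed
  then show ?thesis
    by (intro SSP_arg_min[OF C assms(2) _ _ _ assms(4)]) simp_all
qed

end
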